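(* There exists an $(\mathbb{F}_{p}\times \mathbb{F}_{q},\mathbb{F}_{p}\times \{0\},p,(p-1)/4)$-DF for all prime powers $p$ and $q$ with $p\equiv q\equiv 1 \pmod{4}$ and $q\geq p$.
   Context: For an additive group $G$ with a subgroup $N$, a $(G,N,k,\lambda)$ relative difference family (DF) is a multiset $[B_1,\dots,B_r]$ of $k$-subsets of $G$ such that the multiset $\bigcup_{i}[x-y: x,y\in B_i, x\neq y]$ contains every element of $G\setminus N$ exactly $\lambda$ times and no element of $N$. *)

theory Defs
  imports
    "HOL-Library.Multiset"
    "HOL-Library.Product_Plus"
    "HOL-Library.Cardinality"
    "HOL-Number_Theory.Number_Theory"
begin

text \<open>
  Additive groups are types of class \<^class>\<open>group_add\<close>, so the ambient group is the
  whole type; the subgroup \<open>N\<close> is a set.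
\<close>

definition add_subgroup :: "'g::group_add set \<Rightarrow> bool" where
  "add_subgroup N \<longleftrightarrow> 0 \<in> N \<and> (\<forall>x\<in>N. \<forall>y\<in>N. x + y \<in> N) \<and> (\<forall>x\<in>N. - x \<in> N)"

text \<open>
  \<^const>\<open>mset_set\<close> of an infinite set is empty, so this is only meaningful for finite \<open>B\<close>.
\<close>

definition differences :: "'g::group_add set \<Rightarrow> 'g multiset" where
  "differences B = {#x - y. (x, y) \<in># mset_set {(x, y). x \<in> B \<and> y \<in> B \<and> x \<noteq> y}#}"

definition relative_difference_family ::
    "'g::group_add set \<Rightarrow> nat \<Rightarrow> nat \<Rightarrow> 'g set multiset \<Rightarrow> bool" where
  "relative_difference_family N k l \<B> \<longleftrightarrow>
     add_subgroup N \<and>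
     (\<forall>B\<in>#\<B>. finite B \<and> card B = k) \<and>
     (\<forall>g. count (\<Sum>B\<in>#\<B>. differences B) g = (if g \<in> N then 0 else l))"

end

theory Submission
  imports Defs "HOL-Computational_Algebra.Polynomial"
begin

text \<open>
  Let \<open>j\<close> and \<open>i\<close> be square roots of \<open>-1\<close> in \<open>F\<^sub>p\<close> and \<open>F\<^sub>q\<close>, let
  \<open>f : F\<^sub>p \<rightarrow> F\<^sub>q\<close> be injective with \<open>f 0 = 0\<close> and \<open>f (j x) = i f x\<close>, and let \<open>M\<close> be
  a transversal of \<open>{1, i, -1, -i}\<close> in the multiplicative group of \<open>F\<^sub>q\<close>. The blocks are
  \<open>{(x\<^sup>2, m f x) | x \<in> F\<^sub>p}\<close> for \<open>m \<in> M\<close>.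
  For each \<open>d\<close>, the \<open>p - 1\<close> pairs \<open>x \<noteq> y\<close> with \<open>x\<^sup>2 - y\<^sup>2 = d\<close> are parametrised by
  \<open>u = x - y \<noteq> 0\<close>, and replacing \<open>u\<close> by \<open>j u\<close> amounts to replacing \<open>(x, y)\<close> by
  \<open>(-j y, -j x)\<close>, which multiplies \<open>f x - f y\<close> by \<open>i\<close>. So the values of \<open>f x - f y\<close>
  form \<open>(p - 1) / 4\<close> full orbits of \<open>{1, i, -1, -i}\<close>, and multiplying by \<open>M\<close> hits every
  nonzero element of \<open>F\<^sub>q\<close> exactly \<open>(p - 1) / 4\<close> times.
\<close>

section \<open>Square roots of -1 in finite fields\<close>

lemma card_nonzero: "card (-{0 :: 'a::{zero,finite}}) = CARD('a) - 1"
  by (simp add: Compl_eq_Diff_UNIV card_Diff_singleton)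

text \<open>Multiplication by \<open>x\<close> permutes the nonzero elements; comparing their
  product before and after and cancelling it leaves the power of \<open>x\<close>.\<close>

lemma finite_field_power_card_minus_1:
  fixes x :: "'a::{field,finite}"
  assumes "x \<noteq> 0"
  shows "x ^ (CARD('a) - 1) = 1"
proof -
  have bij: "bij_betw ((*) x) (-{0}) (-{0})"
    by (rule bij_betwI[where g = "\<lambda>y. y / x"]) (use assms in auto)
  have "(\<Prod>y\<in>-{0}. y) = (\<Prod>y\<in>-{0}. x * y)"
    using prod.reindex_bij_betw[OF bij, of "\<lambda>y. y"] by simp
  also have "\<dots> = x ^ card (-{0::'a}) * (\<Prod>y\<in>-{0}. y)"
    by (simp add: prod.distrib)
  also have "card (-{0::'a}) = CARD('a) - 1"
    by (simp add: card_nonzero)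
  finally show ?thesis by simp
qed

lemma card_power_eq_1_le:
  assumes "n > 0"
  shows "card {x :: 'a::field. x ^ n = 1} \<le> n"
proof -
  have deg: "degree (monom 1 n + - 1 :: 'a poly) = n"
    using assms by (subst degree_add_eq_left) (auto simp: degree_monom_eq)
  hence "monom 1 n + - 1 \<noteq> (0 :: 'a poly)" using assms by force
  from card_poly_roots_bound[OF this] show ?thesis
    unfolding deg by (simp add: poly_monom)
qed

text \<open>With \<open>4 * m\<close> nonzero elements and at most \<open>2 * m\<close> roots of
  X^(2m) = 1, some nonzero \<open>x\<close> is not a root. Its power \<open>x ^ (2 * m)\<close>
  squares to 1 without being 1, so it is -1, and \<open>x ^ m\<close> is the square root. The same
  \<open>x\<close> shows that -1 differs from 1.\<close>

lemma obtain_sqrt_minus_one: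
  assumes "[CARD('a::{field,finite}) = 1] (mod 4)"
  obtains i :: "'a::{field,finite}" where "i ^ 2 = - 1" "(-1 :: 'a::{field,finite}) \<noteq> 1"
proof -
  define m where "m = CARD('a) div 4"
  have card: "CARD('a) = 4 * m + 1"
    using assms unfolding m_def cong_def by presburger
  have "card {0, 1 :: 'a} \<le> CARD('a)" by (rule card_mono) auto
  hence m: "m > 0" using card by simp
  have "card {x :: 'a. x ^ (2 * m) = 1} \<le> 2 * m"
    using card_power_eq_1_le[of "2 * m"] m by simp
  moreover have "card (-{0 :: 'a}) = 4 * m" by (simp add: card_nonzero card)
  ultimately have "\<not> -{0 :: 'a} \<subseteq> {x. x ^ (2 * m) = 1}"
    using card_mono[of "{x :: 'a. x ^ (2 * m) = 1}" "-{0}"] m by auto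
  then obtain x :: 'a where x: "x \<noteq> 0" "x ^ (2 * m) \<noteq> 1" by auto
  have "(x ^ (2 * m)) ^ 2 = x ^ (CARD('a) - 1)"
    by (simp add: card flip: power_mult)
  hence "(x ^ (2 * m)) ^ 2 = 1"
    using finite_field_power_card_minus_1[OF x(1)] by simp
  hence "x ^ (2 * m) = -1"
    using x(2) by (simp add: power2_eq_1_iff)
  moreover from this have "(x ^ m) ^ 2 = -1"
    by (simp add: mult.commute flip: power_mult)
  ultimately show ?thesis using that x(2) by metis
qed

section \<open>Orbits of multiplication by a square root of -1\<close>

lemma sqrt_minus_one_power_4: "i ^ 4 = (1 :: 'a::comm_ring_1)" if "i ^ 2 = -1"
  using power_mult[of i 2 2] that by simp

lemma inj_on_sqrt_minus_one_power:
  fixes i :: "'a::field"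
  assumes i: "i ^ 2 = -1" and "(-1::'a) \<noteq> 1"
  shows "inj_on ((^) i) {..<4::nat}"
proof -
  have i0: "i \<noteq> 0" using i by auto
  have "False" if "k < l" "l < 4" "i ^ k = i ^ l" for k l :: nat
  proof -
    have "i ^ k * i ^ (l - k) = i ^ k * 1"
      using that power_add[of i k "l - k"] by simp
    hence "i ^ (l - k) = 1" using i0 by (simp only: mult_cancel_left) simp
    moreover have "l - k = 1 \<or> l - k = 2 \<or> l - k = 3" using that by auto
    moreover have "i ^ 3 = - i" using i by (simp add: eval_nat_numeral)
    ultimately have "i = 1 \<or> i ^ 2 = 1 \<or> - i = 1" using i by auto
    hence "i ^ 2 = 1" by (metis power2_minus power_one)
    thus False using assms by simp
  qed
  thus ?thesis by (metis (mono_tags, lifting) inj_onI lessThan_iff linorder_neqE_nat)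
qed

text \<open>\<open>M\<close> is a transversal of the subgroup \<open>{1, i, -1, -i}\<close> in the multiplicative group.\<close>

lemma obtain_transversal:
  fixes i :: "'a::field"
  assumes i: "i ^ 2 = -1" and ne: "(-1::'a) \<noteq> 1"
  obtains M where "0 \<notin> M" "bij_betw (\<lambda>(k, m). i ^ k * m) ({..<4::nat} \<times> M) (-{0})"
proof -
  have i0: "i \<noteq> 0" using i by auto
  have i4: "i ^ 4 = 1" by (rule sqrt_minus_one_power_4[OF i])
  have mod4: "i ^ (k mod 4) = i ^ k" for k
  proof -
    have "i ^ k = (i ^ 4) ^ (k div 4) * i ^ (k mod 4)"
      by (simp flip: power_mult power_add)
    thus ?thesis by (simp add: i4)
  qed
  \<comment> \<open>\<open>i ^ (3 * k)\<close> is the inverse of \<open>i ^ k\<close>, so exponents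
    stay natural numbers.\<close>
  have inv: "i ^ (3 * k) * (i ^ k * x) = x" for k x
  proof -
    have "i ^ (3 * k) * i ^ k = i ^ (4 * k)" by (simp flip: power_add)
    also have "\<dots> = 1" by (simp add: power_mult i4)
    finally show ?thesis by (simp flip: mult.assoc)
  qed
  define orb where "orb x = range (\<lambda>k. i ^ k * x)" for x
  \<comment> \<open>The choice depends on \<open>x\<close> only through the set
    \<open>orb x\<close>, so \<open>rep\<close> is constant on orbits.\<close>
  define rep where "rep x = (SOME y. y \<in> orb x)" for x
  have self: "x \<in> orb x" for x
    unfolding orb_def by (rule image_eqI[of _ _ 0]) auto
  have rep: "rep x \<in> orb x" for x
    unfolding rep_def by (rule someI[where P = "\<lambda>y. y \<in> orb x"]) (rule self)
  have orb_sub: "orb (i ^ k * x) \<subseteq> orb x" for k x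
    by (auto simp: orb_def simp flip: mult.assoc power_add)
  have orb_eq: "orb (i ^ k * x) = orb x" for k x
  proof
    show "orb x \<subseteq> orb (i ^ k * x)" using orb_sub[of "3 * k" "i ^ k * x"] by (simp only: inv)
  qed (rule orb_sub)
  have rep_eq: "rep (i ^ k * x) = rep x" for k x
    by (simp add: rep_def orb_eq)
  have rep_rep: "rep (rep x) = rep x" for x
    using rep[of x] by (auto simp: orb_def rep_eq)
  define M where "M = rep ` (-{0})"
  have 0: "0 \<notin> M"
  proof
    assume "0 \<in> M"
    then obtain x where x: "x \<noteq> 0" "rep x = 0" by (force simp: M_def)
    obtain k where "rep x = i ^ k * x" using rep[of x] by (auto simp: orb_def)
    thus False using x i0 by simp
  qed
  have "bij_betw (\<lambda>(k, m). i ^ k * m) ({..<4::nat} \<times> M) (-{0})"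
  proof (rule bij_betw_imageI)
    show "inj_on (\<lambda>(k, m). i ^ k * m) ({..<4::nat} \<times> M)"
    proof (rule inj_onI, clarify, goal_cases)
      case (1 k m l n)
      have "rep (i ^ k * m) = rep (i ^ l * n)" by (simp only: 1)
      hence "rep m = rep n" by (simp only: rep_eq)
      hence "m = n" using 1 by (auto simp: M_def rep_rep)
      moreover from this have "k = l"
        using 1 0 inj_on_eq_iff[OF inj_on_sqrt_minus_one_power[OF i ne]] by auto
      ultimately show ?case by simp
    qed
    have "x \<in> (\<lambda>(k, m). i ^ k * m) ` ({..<4::nat} \<times> M)" if "x \<noteq> 0" for x
    proof -
      obtain k where k: "rep x = i ^ k * x" using rep[of x] by (auto simp: orb_def)
      have "i ^ (3 * k) * rep x = x"
        unfolding k by (rule inv)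
      hence "i ^ (3 * k mod 4) * rep x = x" by (simp add: mod4)
      thus ?thesis using that
        by (intro image_eqI[of _ _ "(3 * k mod 4, rep x)"]) (auto simp: M_def)
    qed
    thus "(\<lambda>(k, m). i ^ k * m) ` ({..<4::nat} \<times> M) = -{0}"
      using 0 i0 by auto
  qed
  with 0 show ?thesis using that by blast
qed

text \<open>Since p \<le> q, the orbits of \<open>j\<close> inject into those of \<open>i\<close>
  through an injection \<open>g\<close> of transversals; \<open>f\<close> sends
  \<open>j ^ k * m\<close> to \<open>i ^ k * g m\<close>.\<close>

lemma obtain_equivariant_injection:
  fixes j :: "'a::{field,finite}" and i :: "'b::{field,finite}"
  assumes j: "j ^ 2 = -1" "(-1::'a) \<noteq> 1" and i: "i ^ 2 = -1" "(-1::'b) \<noteq> 1"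
    and le: "CARD('a) \<le> CARD('b)"
  obtains f :: "'a \<Rightarrow> 'b" where "inj f" "f 0 = 0" "\<And>x. f (j * x) = i * f x"
proof -
  obtain M :: "'a set" where M: "0 \<notin> M"
    "bij_betw (\<lambda>(k, m). j ^ k * m) ({..<4::nat} \<times> M) (-{0})" (is "bij_betw ?a _ _")
    by (rule obtain_transversal[OF j])
  obtain N :: "'b set" where N: "0 \<notin> N"
    "bij_betw (\<lambda>(k, m). i ^ k * m) ({..<4::nat} \<times> N) (-{0})" (is "bij_betw ?b _ _")
    by (rule obtain_transversal[OF i])
  have "4 * card M \<le> 4 * card N"
    using bij_betw_same_card[OF M(2)] bij_betw_same_card[OF N(2)] le
    by (simp add: card_cartesian_product card_nonzero)
  then obtain g where g: "inj_on g M" "g ` M \<subseteq> N"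
    using card_le_inj[of M N] by auto
  define t where "t = the_inv_into ({..<4::nat} \<times> M) ?a"
  have t: "t (j ^ k * m) = (k, m)" if "k < 4" "m \<in> M" for k m
    using the_inv_into_f_f[OF bij_betw_imp_inj_on[OF M(2)], of "(k, m)"] that
    by (simp add: t_def)
  define f where "f x = (if x = 0 then 0 else ?b (map_prod id g (t x)))" for x
  have j0: "j \<noteq> 0" and i0: "i \<noteq> 0" using i j by auto
  have f: "f (j ^ k * m) = i ^ k * g m" if "k < 4" "m \<in> M" for k m
    using that M(1) j0 by (auto simp: f_def t)
  have dec: "\<exists>k m. k < 4 \<and> m \<in> M \<and> x = j ^ k * m" if "x \<noteq> 0" for x
  proof -
    have "x \<in> ?a ` ({..<4} \<times> M)" using bij_betw_imp_surj_on[OF M(2)] that by simp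
    thus ?thesis by auto
  qed
  have f_0: "f 0 = 0" by (simp add: f_def)
  have f_eq_0: "x = 0" if "f x = 0" for x
  proof (rule ccontr)
    assume "x \<noteq> 0"
    then obtain k m where km: "k < 4" "m \<in> M" "x = j ^ k * m" using dec by blast
    thus False using that f[OF km(1,2)] i0 g(2) N(1) by auto
  qed
  have "inj f"
  proof (rule injI)
    fix x y assume eq: "f x = f y"
    show "x = y"
    proof (cases "x = 0 \<or> y = 0")
      case True
      thus ?thesis using eq f_0 f_eq_0 by metis
    next
      case False
      then obtain k m l n where km: "k < 4" "m \<in> M" "x = j ^ k * m"
        and ln: "l < 4" "n \<in> M" "y = j ^ l * n" using dec[of x] dec[of y] by blast
      have "?b (k, g m) = ?b (l, g n)" using eq km ln f by simp
      hence "(k, g m) = (l, g n)"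
        by (rule inj_onD[OF bij_betw_imp_inj_on[OF N(2)]]) (use km ln g(2) in auto)
      thus ?thesis using km ln inj_on_eq_iff[OF g(1)] by simp
    qed
  qed
  moreover have "f (j * x) = i * f x" for x
  proof (cases "x = 0")
    case False
    then obtain k m where km: "k < 4" "m \<in> M" "x = j ^ k * m" using dec by blast
    show ?thesis
    \<comment> \<open>Multiplication by \<open>j\<close> raises the exponent by one, except that 3
      wraps around to 0, as the formula for \<open>f\<close> is available only below 4.\<close>
    proof (cases "k = 3")
      case True
      have "j * x = j ^ 0 * m"
        using sqrt_minus_one_power_4[OF j(1)] km True
        by (simp add: eval_nat_numeral mult.assoc)
      hence "f (j * x) = g m" using f[of 0 m] km by (simp only:) simp
      moreover have "i * f x = i ^ 4 * g m"
        using km f[of 3 m] True by (simp add: eval_nat_numeral mult.assoc)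
      ultimately show ?thesis using sqrt_minus_one_power_4[OF i(1)] by simp
    next
      case False
      hence "Suc k < 4" using km by simp
      thus ?thesis using f[of "Suc k" m] f[of k m] km by (simp add: mult.assoc)
    qed
  qed (simp add: f_0)
  ultimately show ?thesis using that f_0 by blast
qed

text \<open>Replacing \<open>u\<close> by \<open>j ^ k * u\<close> divides \<open>e / w u\<close> by
  \<open>i ^ k\<close>. As \<open>e / w u\<close> is uniquely \<open>i ^ k * m\<close> with
  \<open>m\<close> in \<open>M\<close>, exactly one member of each \<open>j\<close>-orbit is
  counted.\<close>

lemma card_equivariant_transversal:
  fixes j :: "'a::{field,finite}" and i :: "'b::field" and w :: "'a \<Rightarrow> 'b"
  assumes j: "j ^ 2 = -1" and i: "i ^ 2 = -1"
    and M: "0 \<notin> M" "bij_betw (\<lambda>(k, m). i ^ k * m) ({..<4::nat} \<times> M) (-{0})"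
    and w0: "\<And>u. u \<noteq> 0 \<Longrightarrow> w u \<noteq> 0"
    and w: "\<And>u. u \<noteq> 0 \<Longrightarrow> w (j * u) = i * w u"
    and e: "e \<noteq> 0"
  shows "4 * card {u. u \<noteq> 0 \<and> e / w u \<in> M} = CARD('a) - 1"
proof -
  have j0: "j \<noteq> 0" and i0: "i \<noteq> 0" using i j by auto
  have wk: "w (j ^ k * u) = i ^ k * w u" if "u \<noteq> 0" for k u
  proof (induction k)
    case (Suc k)
    have "w (j * (j ^ k * u)) = i * w (j ^ k * u)" by (rule w) (use that j0 in simp)
    thus ?case by (simp only: Suc power_Suc mult.assoc)
  qed simp
  let ?U = "{u. u \<noteq> 0 \<and> e / w u \<in> M}"
  have "bij_betw (\<lambda>(k, u). j ^ k * u) ({..<4::nat} \<times> ?U) (-{0})"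
  proof (rule bij_betw_imageI)
    show "inj_on (\<lambda>(k, u). j ^ k * u) ({..<4::nat} \<times> ?U)"
    proof (rule inj_onI, clarify, goal_cases)
      case (1 k u l v)
      have "i ^ k * w u = i ^ l * w v" using wk[of u k] wk[of v l] 1 by simp
      \<comment> \<open>Inverting the equation swaps \<open>u\<close> and \<open>v\<close> and gives
        two decompositions over \<open>M\<close> of one element, whence
        \<open>k = l\<close>.\<close>
      moreover have "i ^ k * (e / w v) = e * (i ^ k * w u) / (w u * w v)"
        "i ^ l * (e / w u) = e * (i ^ l * w v) / (w u * w v)"
        using w0[of u] w0[of v] 1 by simp_all
      ultimately have "i ^ k * (e / w v) = i ^ l * (e / w u)" by simp
      hence "(k, e / w v) = (l, e / w u)"
        by (intro inj_onD[OF bij_betw_imp_inj_on[OF M(2)]]) (use 1 in auto)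
      hence "k = l" by simp
      with 1 j0 show ?case by simp
    qed
    have "v \<in> (\<lambda>(k, u). j ^ k * u) ` ({..<4::nat} \<times> ?U)" if v: "v \<noteq> 0" for v
    proof -
      have "e / w v \<in> (\<lambda>(k, m). i ^ k * m) ` ({..<4::nat} \<times> M)"
        using bij_betw_imp_surj_on[OF M(2)] v w0 e by simp
      then obtain k m where km: "k < 4" "m \<in> M" "e / w v = i ^ k * m" by auto
      have "e / w (j ^ k * v) = m"
      proof -
        have "m = e / w v / i ^ k" using km(3) i0 by simp
        thus ?thesis by (simp add: wk[OF v] mult.commute[of "w v"])
      qed
      hence U: "j ^ k * v \<in> ?U" using km v j0 by simp
      \<comment> \<open>Reducing mod 4 matters for \<open>k = 0\<close>, where the inverse exponent
        4 would be out of range.\<close>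
      have "j ^ ((4 - k) mod 4) * (j ^ k * v) = v"
      proof (cases "k = 0")
        case False
        hence "j ^ (4 - k) * j ^ k = 1"
          using km(1) power_add[of j "4 - k" k] sqrt_minus_one_power_4[OF j] by simp
        with False show ?thesis by (simp flip: mult.assoc)
      qed simp
      with U show ?thesis
        by (intro image_eqI[of _ _ "((4 - k) mod 4, j ^ k * v)"]) auto
    qed
    thus "(\<lambda>(k, u). j ^ k * u) ` ({..<4::nat} \<times> ?U) = -{0}"
      using j0 by auto
  qed
  from bij_betw_same_card[OF this] show ?thesis
    by (simp add: card_cartesian_product card_nonzero)
qed

section \<open>Differences within a block and solutions of x^2 - y^2 = d\<close>

lemma count_differences_image:
  fixes h :: "'a::finite \<Rightarrow> 'g::group_add"
  assumes "inj h"
  shows "count (differences (range h)) g = card {(x, y). x \<noteq> y \<and> h x - h y = g}"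
proof -
  let ?P = "{(a, b). a \<in> range h \<and> b \<in> range h \<and> a \<noteq> b}"
  have eq: "?P = map_prod h h ` {(x, y). x \<noteq> y}"
    using assms by (auto simp: inj_eq)
  have fin: "finite ?P" unfolding eq by simp
  have "count (differences (range h)) g = card {z \<in> ?P. fst z - snd z = g}"
    unfolding differences_def count_image_mset using fin
    by (auto simp: case_prod_beta intro!: arg_cong[of _ _ card])
  also have "{z \<in> ?P. fst z - snd z = g} = map_prod h h ` {(x, y). x \<noteq> y \<and> h x - h y = g}"
    using assms by (auto simp: inj_eq)
  also have "card \<dots> = card {(x, y). x \<noteq> y \<and> h x - h y = g}"
    using assms by (intro card_image inj_on_subset[OF prod.inj_map]) auto
  finally show ?thesis .
qed

text \<open>Factoring, \<open>u = x - y\<close> forces \<open>x + y = d / u\<close>, and 2 is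
  invertible. The case \<open>d = 0\<close> is included.\<close>

lemma bij_betw_square_differences:
  fixes d :: "'a::field"
  assumes "(-1::'a) \<noteq> 1"
  shows "bij_betw (\<lambda>u. ((d / u + u) / 2, (d / u - u) / 2)) (-{0})
           {(x, y). x \<noteq> y \<and> x ^ 2 - y ^ 2 = d}"
proof -
  have two: "(2::'a) \<noteq> 0"
    using assms by (metis add_eq_0_iff one_add_one)
  have diff: "(d / u + u) / 2 - (d / u - u) / 2 = u"
    and sum: "(d / u + u) / 2 + (d / u - u) / 2 = d / u" for u
    unfolding diff_divide_distrib[symmetric] add_divide_distrib[symmetric]
    using two by simp_all
  have squares: "((d / u + u) / 2) ^ 2 - ((d / u - u) / 2) ^ 2 = d" if "u \<noteq> 0" for u
    unfolding power2_eq_square square_diff_square_factored diff sum using that by simp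
  have ne: "(d / u + u) / 2 \<noteq> (d / u - u) / 2" if "u \<noteq> 0" for u
    using diff[of u] that by (metis right_minus_eq)
  have quot: "(x ^ 2 - y ^ 2) / (x - y) = x + y" if "x \<noteq> y" for x y :: 'a
    using that by (simp add: field_simps power2_eq_square)
  show ?thesis
  proof (rule bij_betw_byWitness[where f' = "\<lambda>(x, y). x - y"])
    show "\<forall>u\<in>-{0}. (\<lambda>(x, y). x - y) ((d / u + u) / 2, (d / u - u) / 2) = u"
      by (simp add: diff)
    show "(\<lambda>u. ((d / u + u) / 2, (d / u - u) / 2)) ` (-{0})
        \<subseteq> {(x, y). x \<noteq> y \<and> x ^ 2 - y ^ 2 = d}"
      by (intro image_subsetI CollectI case_prodI conjI ne squares) auto
  qed (auto simp: quot two)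
qed

section \<open>The blocks and the count of their differences\<close>

lemma add_subgroup_UNIV_times_0:
  "add_subgroup (UNIV \<times> {0} :: ('a::group_add \<times> 'b::group_add) set)"
  by (auto simp: add_subgroup_def zero_prod_def)

theorem theorem3p11:
  fixes p q :: nat
  assumes "primepow p" and "primepow q"
    and "[p = 1] (mod 4)" and "[q = 1] (mod 4)"
    and "q \<ge> p"
    and "CARD('a::{field,finite}) = p" and "CARD('b::{field,finite}) = q"
  shows "\<exists>\<B> :: ('a \<times> 'b) set multiset.
           relative_difference_family (UNIV \<times> {0}) p ((p - 1) div 4) \<B>"
proof -
  obtain j :: 'a where j: "j ^ 2 = -1" "(-1::'a) \<noteq> 1"
    using obtain_sqrt_minus_one assms by metis
  obtain i :: 'b where i: "i ^ 2 = -1" "(-1::'b) \<noteq> 1"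
    using obtain_sqrt_minus_one assms by metis
  obtain f :: "'a \<Rightarrow> 'b" where f: "inj f" "f 0 = 0" "\<And>x. f (j * x) = i * f x"
    using obtain_equivariant_injection[OF j i] assms by metis
  obtain M :: "'b set" where M: "0 \<notin> M"
    "bij_betw (\<lambda>(k, m). i ^ k * m) ({..<4::nat} \<times> M) (-{0})"
    by (rule obtain_transversal[OF i])
  have j0: "j \<noteq> 0" using j(1) by auto
  \<comment> \<open>Oddness comes from applying equivariance twice, as \<open>j ^ 2\<close> and
    \<open>i ^ 2\<close> are both -1.\<close>
  have f_uminus: "f (- x) = - f x" for x
    using f(3)[of "j * x"] f(3)[of x] i(1) j(1)
    by (simp add: power2_eq_square flip: mult.assoc)
  define h where "h m x = (x ^ 2, m * f x)" for m x
  \<comment> \<open>Squaring is not injective, but the second coordinate is, because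
    \<open>m\<close> is nonzero.\<close>
  have inj_h: "inj (h m)" if "m \<in> M" for m
    using that M(1) f(1) by (auto simp: h_def inj_def)
  \<comment> \<open>The second coordinate, before scaling by \<open>m\<close>, of the difference of
    the points at the \<open>x\<close> and \<open>y\<close> with \<open>x - y = u\<close> and
    \<open>x ^ 2 - y ^ 2 = d\<close>.\<close>
  define w where "w d u = f ((d / u + u) / 2) - f ((d / u - u) / 2)" for d u
  have w0: "w d u \<noteq> 0" if "u \<noteq> 0" for d u
  proof -
    have "(d / u + u) / 2 \<noteq> (d / u - u) / 2"
      using bij_betwE[OF bij_betw_square_differences[OF j(2), of d]] that by blast
    thus ?thesis by (simp only: w_def inj_eq[OF f(1)] right_minus_eq not_False_eq_True)
  qed
  have w_j: "w d (j * u) = i * w d u" if "u \<noteq> 0" for d u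
  proof -
    have "d / (j * u) = - (j * (d / u))"
      using j0 j(1) that by (simp add: field_simps power2_eq_square)
    hence "(d / (j * u) + j * u) / 2 = - (j * ((d / u - u) / 2))"
      "(d / (j * u) - j * u) / 2 = - (j * ((d / u + u) / 2))"
      by (simp_all add: diff_divide_distrib add_divide_distrib algebra_simps)
    thus ?thesis by (simp only: w_def f_uminus f(3)) (simp add: algebra_simps)
  qed
  have count_h: "count (differences (range (h m))) (d, e) = card {u. u \<noteq> 0 \<and> m * w d u = e}"
    if m: "m \<in> M" for m d e
  proof -
    have "{(x, y). x \<noteq> y \<and> h m x - h m y = (d, e)} =
      {z \<in> {(x, y). x \<noteq> y \<and> x ^ 2 - y ^ 2 = d}. m * (f (fst z) - f (snd z)) = e}"
      by (auto simp: h_def algebra_simps)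
    also have "\<dots> = (\<lambda>u. ((d / u + u) / 2, (d / u - u) / 2)) ` {u. u \<noteq> 0 \<and> m * w d u = e}"
      unfolding bij_betw_imp_surj_on[OF bij_betw_square_differences[OF j(2)], symmetric]
      by (auto simp: w_def)
    also have "card \<dots> = card {u. u \<noteq> 0 \<and> m * w d u = e}"
      by (intro card_image inj_on_subset[OF bij_betw_imp_inj_on[OF bij_betw_square_differences[OF j(2)]]])
        auto
    finally show ?thesis by (simp add: count_differences_image[OF inj_h[OF m]])
  qed
  define \<B> where "\<B> = image_mset (\<lambda>m. range (h m)) (mset_set M)"
  have "count (\<Sum>B\<in>#\<B>. differences B) g = (if g \<in> UNIV \<times> {0} then 0 else (p - 1) div 4)" for g
  proof -
    obtain d e where g: "g = (d, e)" by (cases g)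
    have "count (\<Sum>B\<in>#\<B>. differences B) g = (\<Sum>m\<in>M. count (differences (range (h m))) g)"
      by (simp add: \<B>_def sum_unfold_sum_mset[symmetric] count_sum image_mset.compositionality comp_def)
    also have "\<dots> = (\<Sum>m\<in>M. card {u. u \<noteq> 0 \<and> m * w d u = e})"
      by (simp add: g count_h)
    \<comment> \<open>The sets are disjoint: since \<open>w d u\<close> is nonzero, \<open>u\<close>
      determines \<open>m\<close> as \<open>e / w d u\<close>.\<close>
    also have "\<dots> = card (\<Union>m\<in>M. {u. u \<noteq> 0 \<and> m * w d u = e})"
      using M(1) w0 by (intro card_UN_disjoint[symmetric]) auto
    also have "\<dots> = (if e = 0 then 0 else (p - 1) div 4)"
    proof (cases "e = 0")
      case True
      hence "(\<Union>m\<in>M. {u. u \<noteq> 0 \<and> m * w d u = e}) = {}" using M(1) w0 by auto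
      thus ?thesis using True by simp
    next
      case False
      have "(\<Union>m\<in>M. {u. u \<noteq> 0 \<and> m * w d u = e}) = {u. u \<noteq> 0 \<and> e / w d u \<in> M}"
        using w0 by (auto simp: field_simps)
      moreover have "4 * card {u. u \<noteq> 0 \<and> e / w d u \<in> M} = p - 1"
        using card_equivariant_transversal[where w = "w d", OF j(1) i(1) M w0 w_j False] assms(6) by simp
      ultimately show ?thesis using False by simp
    qed
    finally show ?thesis by (simp add: g)
  qed
  moreover have "finite B \<and> card B = p" if "B \<in># \<B>" for B
    using that inj_h assms(6) by (auto simp: \<B>_def card_image)
  ultimately have "relative_difference_family (UNIV \<times> {0}) p ((p - 1) div 4) \<B>"
    by (simp add: relative_difference_family_def add_subgroup_UNIV_times_0)
  thus ?thesis by blast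
qed

end
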